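(* Let $\mathcal{C}$ be a complete category, and let $(\mathbb{E},\mathbb{M})$ be a factorization system on $\mathcal{C}$ such that every morphism in $\mathbb{E}$ is an epimorphism. Let $\mathcal{C}$ be $\mathbb{E}$-co-well-powered, and let $\mathcal{X}$ be a full replete subcategory of $\mathcal{C}$. The following conditions are equivalent: (i) $\mathcal{X}$ is closed under products and under $\mathbb{M}$-subobjects; (ii) $\mathcal{X}$ is a reflective subcategory of $\mathcal{C}$, and the components of the reflection unit lie in $\mathbb{E}$; (iii) $\mathcal{X}$ is a reflective subcategory of $\mathcal{C}$ and is closed under $\mathbb{M}$-subobjects.
   Context: A factorization system is meant in the usual orthogonal sense: $\mathbb{E}$ and $\mathbb{M}$ contain the isomorphisms and are closed under composition, every morphism factors as $me$ with $e\in\mathbb{E}$, $m\in\mathbb{M}$, and every commutative square with left side in $\mathbb{E}$ and right side in $\mathbb{M}$ has a unique diagonal filler. $\mathcal{C}$ is $\mathbb{E}$-co-well-powered if for every object $C$ the class of $\mathbb{E}$-morphisms with domain $C$, modulo the natural equivalence ($e:C\to A$ and $e':C\to A'$ are equivalent if $e'=he$ for an isomorphism $h$), is a set. $\mathcal{X}$ is closed under $\mathbb{M}$-subobjects if whenever $m:X\to X'$ lies in $\mathbb{M}$ and $X'$ is an object of $\mathcal{X}$, then $X$ is an object of $\mathcal{X}$. Closed under products means closed under (small) products formed in $\mathcal{C}$. Replete means closed under isomorphisms. *)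

theory Defs
  imports Main "HOL-Library.Equipollence"
begin

record ('o, 'a) cat =
  Obj :: "'o set"
  Arr :: "'a set"
  Dom :: "'a \<Rightarrow> 'o"
  Cod :: "'a \<Rightarrow> 'o"
  Id :: "'o \<Rightarrow> 'a"
  Comp :: "'a \<Rightarrow> 'a \<Rightarrow> 'a"  (infixr "\<cdot>\<index>" 70)

text \<open>Composition is in applicative order: \<open>g \<cdot>\<^bsub>C\<^esub> f\<close> is ``first \<open>f\<close>, then \<open>g\<close>''. The
  operations are only meaningful on the carriers \<open>Obj C\<close> and \<open>Arr C\<close>.\<close>

definition hom :: "('o, 'a) cat \<Rightarrow> 'o \<Rightarrow> 'o \<Rightarrow> 'a set" where
  "hom C A B = {f \<in> Arr C. Dom C f = A \<and> Cod C f = B}"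

locale category =
  fixes C :: "('o, 'a) cat" (structure)
  assumes Dom_Obj: "f \<in> Arr C \<Longrightarrow> Dom C f \<in> Obj C"
    and Cod_Obj: "f \<in> Arr C \<Longrightarrow> Cod C f \<in> Obj C"
    and Id_hom: "A \<in> Obj C \<Longrightarrow> Id C A \<in> hom C A A"
    and Comp_hom: "f \<in> hom C A B \<Longrightarrow> g \<in> hom C B D \<Longrightarrow> g \<cdot> f \<in> hom C A D"
    and Id_left: "f \<in> hom C A B \<Longrightarrow> Id C B \<cdot> f = f"
    and Id_right: "f \<in> hom C A B \<Longrightarrow> f \<cdot> Id C A = f"
    and Comp_assoc: "f \<in> hom C A B \<Longrightarrow> g \<in> hom C B D \<Longrightarrow> h \<in> hom C D F
      \<Longrightarrow> (h \<cdot> g) \<cdot> f = h \<cdot> (g \<cdot> f)"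

definition iso :: "('o, 'a) cat \<Rightarrow> 'a \<Rightarrow> bool" where
  "iso C f \<longleftrightarrow> f \<in> Arr C \<and>
    (\<exists>g \<in> hom C (Cod C f) (Dom C f).
      g \<cdot>\<^bsub>C\<^esub> f = Id C (Dom C f) \<and> f \<cdot>\<^bsub>C\<^esub> g = Id C (Cod C f))"

definition epi :: "('o, 'a) cat \<Rightarrow> 'a \<Rightarrow> bool" where
  "epi C e \<longleftrightarrow> e \<in> Arr C \<and>
    (\<forall>B. \<forall>g \<in> hom C (Cod C e) B. \<forall>h \<in> hom C (Cod C e) B.
      g \<cdot>\<^bsub>C\<^esub> e = h \<cdot>\<^bsub>C\<^esub> e \<longrightarrow> g = h)"

record ('o1, 'a1, 'o2, 'a2) functor_maps =
  OMap :: "'o1 \<Rightarrow> 'o2"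
  AMap :: "'a1 \<Rightarrow> 'a2"

definition is_functor ::
  "('o1, 'a1) cat \<Rightarrow> ('o2, 'a2) cat \<Rightarrow> ('o1, 'a1, 'o2, 'a2) functor_maps \<Rightarrow> bool" where
  "is_functor C D F \<longleftrightarrow> category C \<and> category D \<and>
    (\<forall>A \<in> Obj C. OMap F A \<in> Obj D) \<and>
    (\<forall>f \<in> Arr C. AMap F f \<in> hom D (OMap F (Dom C f)) (OMap F (Cod C f))) \<and>
    (\<forall>A \<in> Obj C. AMap F (Id C A) = Id D (OMap F A)) \<and>
    (\<forall>f \<in> Arr C. \<forall>g \<in> Arr C. Cod C f = Dom C g \<longrightarrow>
      AMap F (g \<cdot>\<^bsub>C\<^esub> f) = AMap F g \<cdot>\<^bsub>D\<^esub> AMap F f)"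

text \<open>The same pair of identity maps also serves as the inclusion of a subcategory.\<close>

definition identity_maps :: "('o, 'a, 'o, 'a) functor_maps" where
  "identity_maps = \<lparr>OMap = (\<lambda>A. A), AMap = (\<lambda>f. f)\<rparr>"

definition functor_comp ::
  "('o2, 'a2, 'o3, 'a3) functor_maps \<Rightarrow> ('o1, 'a1, 'o2, 'a2) functor_maps
    \<Rightarrow> ('o1, 'a1, 'o3, 'a3) functor_maps" where
  "functor_comp G F = \<lparr>OMap = OMap G \<circ> OMap F, AMap = AMap G \<circ> AMap F\<rparr>"

definition nat_trans ::
  "('o1, 'a1) cat \<Rightarrow> ('o2, 'a2) cat \<Rightarrow> ('o1, 'a1, 'o2, 'a2) functor_maps
    \<Rightarrow> ('o1, 'a1, 'o2, 'a2) functor_maps \<Rightarrow> ('o1 \<Rightarrow> 'a2) \<Rightarrow> bool" where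
  "nat_trans C D F G \<eta> \<longleftrightarrow> is_functor C D F \<and> is_functor C D G \<and>
    (\<forall>A \<in> Obj C. \<eta> A \<in> hom D (OMap F A) (OMap G A)) \<and>
    (\<forall>f \<in> Arr C. \<eta> (Cod C f) \<cdot>\<^bsub>D\<^esub> AMap F f = AMap G f \<cdot>\<^bsub>D\<^esub> \<eta> (Dom C f))"

text \<open>\<open>F : C \<rightarrow> D\<close> is left adjoint to \<open>G : D \<rightarrow> C\<close> with unit \<open>\<eta>\<close>. The
  bijection \<open>D(F A, Y) \<cong> C(A, G Y)\<close> is written through the unit, so its naturality in
  \<open>A\<close> and \<open>Y\<close> is the naturality of \<open>\<eta>\<close> and the functoriality of \<open>G\<close>.\<close>

definition adjunction ::
  "('o1, 'a1) cat \<Rightarrow> ('o2, 'a2) cat \<Rightarrow> ('o1, 'a1, 'o2, 'a2) functor_maps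
    \<Rightarrow> ('o2, 'a2, 'o1, 'a1) functor_maps \<Rightarrow> ('o1 \<Rightarrow> 'a1) \<Rightarrow> bool" where
  "adjunction C D F G \<eta> \<longleftrightarrow> is_functor C D F \<and> is_functor D C G \<and>
    nat_trans C C identity_maps (functor_comp G F) \<eta> \<and>
    (\<forall>A \<in> Obj C. \<forall>Y \<in> Obj D.
      bij_betw (\<lambda>g. AMap G g \<cdot>\<^bsub>C\<^esub> \<eta> A) (hom D (OMap F A) Y) (hom C A (OMap G Y)))"

text \<open>Smallness is relative to a type \<open>'u\<close>: a set is small if its cardinality is strictly
  below that of \<open>'u\<close>. For \<open>'u\<close> of inaccessible cardinality this is smallness with
  respect to a Grothendieck universe; nothing is assumed about the cardinality of \<open>'u\<close>.\<close>

definition small :: "'u itself \<Rightarrow> 'b set \<Rightarrow> bool" where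
  "small U A \<longleftrightarrow> A \<prec> (UNIV :: 'u set)"

definition is_cone ::
  "('j, 'k) cat \<Rightarrow> ('o, 'a) cat \<Rightarrow> ('j, 'k, 'o, 'a) functor_maps
    \<Rightarrow> 'o \<Rightarrow> ('j \<Rightarrow> 'a) \<Rightarrow> bool" where
  "is_cone J C T L p \<longleftrightarrow> L \<in> Obj C \<and>
    (\<forall>j \<in> Obj J. p j \<in> hom C L (OMap T j)) \<and>
    (\<forall>u \<in> Arr J. AMap T u \<cdot>\<^bsub>C\<^esub> p (Dom J u) = p (Cod J u))"

definition is_limit ::
  "('j, 'k) cat \<Rightarrow> ('o, 'a) cat \<Rightarrow> ('j, 'k, 'o, 'a) functor_maps
    \<Rightarrow> 'o \<Rightarrow> ('j \<Rightarrow> 'a) \<Rightarrow> bool" where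
  "is_limit J C T L p \<longleftrightarrow> is_cone J C T L p \<and>
    (\<forall>B q. is_cone J C T B q \<longrightarrow>
      (\<exists>!h. h \<in> hom C B L \<and> (\<forall>j \<in> Obj J. p j \<cdot>\<^bsub>C\<^esub> h = q j)))"

text \<open>Every category with a small set of arrows is isomorphic to one whose objects and arrows
  are elements of \<open>'u\<close>, so it suffices to consider index categories of that form; likewise
  for the index sets of small products.\<close>

definition complete_cat :: "'u itself \<Rightarrow> ('o, 'a) cat \<Rightarrow> bool" where
  "complete_cat U C \<longleftrightarrow> category C \<and>
    (\<forall>(J :: ('u, 'u) cat) T. small U (Obj J) \<and> small U (Arr J) \<and> is_functor J C T \<longrightarrow>
      (\<exists>L p. is_limit J C T L p))"

definition is_product ::
  "('o, 'a) cat \<Rightarrow> 'i set \<Rightarrow> ('i \<Rightarrow> 'o) \<Rightarrow> 'o \<Rightarrow> ('i \<Rightarrow> 'a) \<Rightarrow> bool" where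
  "is_product C I F P p \<longleftrightarrow> P \<in> Obj C \<and>
    (\<forall>i \<in> I. F i \<in> Obj C \<and> p i \<in> hom C P (F i)) \<and>
    (\<forall>B q. B \<in> Obj C \<and> (\<forall>i \<in> I. q i \<in> hom C B (F i)) \<longrightarrow>
      (\<exists>!h. h \<in> hom C B P \<and> (\<forall>i \<in> I. p i \<cdot>\<^bsub>C\<^esub> h = q i)))"

definition factorization_system :: "('o, 'a) cat \<Rightarrow> 'a set \<Rightarrow> 'a set \<Rightarrow> bool" where
  "factorization_system C E M \<longleftrightarrow> E \<subseteq> Arr C \<and> M \<subseteq> Arr C \<and>
    (\<forall>f. iso C f \<longrightarrow> f \<in> E \<and> f \<in> M) \<and>
    (\<forall>f \<in> E. \<forall>g \<in> E. Cod C f = Dom C g \<longrightarrow> g \<cdot>\<^bsub>C\<^esub> f \<in> E) \<and>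
    (\<forall>f \<in> M. \<forall>g \<in> M. Cod C f = Dom C g \<longrightarrow> g \<cdot>\<^bsub>C\<^esub> f \<in> M) \<and>
    (\<forall>f \<in> Arr C. \<exists>e \<in> E. \<exists>m \<in> M. Cod C e = Dom C m \<and> f = m \<cdot>\<^bsub>C\<^esub> e) \<and>
    (\<forall>e \<in> E. \<forall>m \<in> M. \<forall>u \<in> hom C (Dom C e) (Dom C m). \<forall>v \<in> hom C (Cod C e) (Cod C m).
      m \<cdot>\<^bsub>C\<^esub> u = v \<cdot>\<^bsub>C\<^esub> e \<longrightarrow>
      (\<exists>!d. d \<in> hom C (Cod C e) (Dom C m) \<and> d \<cdot>\<^bsub>C\<^esub> e = u \<and> m \<cdot>\<^bsub>C\<^esub> d = v))"

definition morphisms_from :: "('o, 'a) cat \<Rightarrow> 'a set \<Rightarrow> 'o \<Rightarrow> 'a set" where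
  "morphisms_from C E A = {e \<in> E. Dom C e = A}"

definition quotient_equiv :: "('o, 'a) cat \<Rightarrow> 'a set \<Rightarrow> 'o \<Rightarrow> ('a \<times> 'a) set" where
  "quotient_equiv C E A =
    {(e, e'). e \<in> morphisms_from C E A \<and> e' \<in> morphisms_from C E A \<and>
      (\<exists>h \<in> hom C (Cod C e) (Cod C e'). iso C h \<and> e' = h \<cdot>\<^bsub>C\<^esub> e)}"

definition co_well_powered :: "'u itself \<Rightarrow> ('o, 'a) cat \<Rightarrow> 'a set \<Rightarrow> bool" where
  "co_well_powered U C E \<longleftrightarrow>
    (\<forall>A \<in> Obj C. small U (morphisms_from C E A // quotient_equiv C E A))"

definition subcategory :: "('o, 'a) cat \<Rightarrow> ('o, 'a) cat \<Rightarrow> bool" where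
  "subcategory X C \<longleftrightarrow> category X \<and> category C \<and> Obj X \<subseteq> Obj C \<and> Arr X \<subseteq> Arr C \<and>
    (\<forall>f \<in> Arr X. Dom X f = Dom C f \<and> Cod X f = Cod C f) \<and>
    (\<forall>A \<in> Obj X. Id X A = Id C A) \<and>
    (\<forall>f \<in> Arr X. \<forall>g \<in> Arr X. Cod X f = Dom X g \<longrightarrow> g \<cdot>\<^bsub>X\<^esub> f = g \<cdot>\<^bsub>C\<^esub> f)"

definition full_subcategory :: "('o, 'a) cat \<Rightarrow> ('o, 'a) cat \<Rightarrow> bool" where
  "full_subcategory X C \<longleftrightarrow> subcategory X C \<and>
    (\<forall>A \<in> Obj X. \<forall>B \<in> Obj X. hom X A B = hom C A B)"

definition replete :: "('o, 'a) cat \<Rightarrow> ('o, 'a) cat \<Rightarrow> bool" where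
  "replete X C \<longleftrightarrow> (\<forall>f. iso C f \<and> Dom C f \<in> Obj X \<longrightarrow> Cod C f \<in> Obj X)"

definition closed_under_products :: "'u itself \<Rightarrow> ('o, 'a) cat \<Rightarrow> ('o, 'a) cat \<Rightarrow> bool" where
  "closed_under_products U X C \<longleftrightarrow>
    (\<forall>(I :: 'u set) F P p. small U I \<and> (\<forall>i \<in> I. F i \<in> Obj X) \<and> is_product C I F P p \<longrightarrow>
      P \<in> Obj X)"

definition closed_under_subobjects ::
  "('o, 'a) cat \<Rightarrow> ('o, 'a) cat \<Rightarrow> 'a set \<Rightarrow> bool" where
  "closed_under_subobjects X C M \<longleftrightarrow>
    (\<forall>m \<in> M. Cod C m \<in> Obj X \<longrightarrow> Dom C m \<in> Obj X)"

definition is_reflection ::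
  "('o, 'a) cat \<Rightarrow> ('o, 'a) cat \<Rightarrow> ('o, 'a, 'o, 'a) functor_maps \<Rightarrow> ('o \<Rightarrow> 'a) \<Rightarrow> bool" where
  "is_reflection X C R \<eta> \<longleftrightarrow> subcategory X C \<and> adjunction C X R identity_maps \<eta>"

definition reflective :: "('o, 'a) cat \<Rightarrow> ('o, 'a) cat \<Rightarrow> bool" where
  "reflective X C \<longleftrightarrow> (\<exists>R \<eta>. is_reflection X C R \<eta>)"

end

theory Submission
  imports Defs
begin

text \<open>A reflection with unit in \<open>E\<close> is built from a generalized solution set: the product of
  representatives of all \<open>E\<close>-quotients of \<open>A\<close> lying in \<open>X\<close> receives a map from \<open>A\<close>, and the
  \<open>E\<close>-part of its factorization is universal, since a morphism from \<open>A\<close> into \<open>X\<close> factors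
  through its own \<open>E\<close>-part, one of the chosen quotients. For the converses, a universal arrow out of
  \<open>A\<close> that has a left inverse is an isomorphism, so \<open>A\<close> lies in \<open>X\<close>; for a product the left
  inverse comes from its universal property, for an \<open>M\<close>-subobject from the diagonal filler. Finally,
  if \<open>X\<close> is closed under \<open>M\<close>-subobjects, then the \<open>E\<close>-part of a reflection unit already lands in
  \<open>X\<close>, which forces the \<open>M\<close>-part to be an isomorphism.\<close>

section \<open>Universal arrows from an object to a subcategory\<close>

definition universal_arrow :: "('o, 'a) cat \<Rightarrow> ('o, 'a) cat \<Rightarrow> 'o \<Rightarrow> 'o \<Rightarrow> 'a \<Rightarrow> bool" where
  "universal_arrow C X A B e \<longleftrightarrow> B \<in> Obj X \<and> e \<in> hom C A B \<and>
    (\<forall>Y \<in> Obj X. \<forall>f \<in> hom C A Y. \<exists>!g. g \<in> hom C B Y \<and> g \<cdot>\<^bsub>C\<^esub> e = f)"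

lemma homD:
  assumes "f \<in> hom C A B"
  shows "f \<in> Arr C" "Dom C f = A" "Cod C f = B"
  using assms by (auto simp: hom_def)

lemma universal_arrowD:
  assumes "universal_arrow C X A B e"
  shows "B \<in> Obj X" "e \<in> hom C A B"
  using assms by (auto simp: universal_arrow_def)

lemma universal_arrow_ex:
  assumes "universal_arrow C X A B e" "Y \<in> Obj X" "f \<in> hom C A Y"
  obtains g where "g \<in> hom C B Y" "g \<cdot>\<^bsub>C\<^esub> e = f"
  using assms unfolding universal_arrow_def by blast

lemma epiD:
  assumes "epi C e" "e \<in> hom C A B" "g \<in> hom C B D" "h \<in> hom C B D"
    and "g \<cdot>\<^bsub>C\<^esub> e = h \<cdot>\<^bsub>C\<^esub> e"
  shows "g = h"
  using assms unfolding epi_def by (auto dest: homD)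

lemma full_subcategoryD:
  assumes "full_subcategory X C"
  shows "subcategory X C" "category X" "category C" "Obj X \<subseteq> Obj C" "Arr X \<subseteq> Arr C"
    and "\<And>f. f \<in> Arr X \<Longrightarrow> Dom X f = Dom C f" "\<And>f. f \<in> Arr X \<Longrightarrow> Cod X f = Cod C f"
    and "\<And>A. A \<in> Obj X \<Longrightarrow> Id X A = Id C A"
    and "\<And>f g. f \<in> Arr X \<Longrightarrow> g \<in> Arr X \<Longrightarrow> Cod X f = Dom X g \<Longrightarrow> g \<cdot>\<^bsub>X\<^esub> f = g \<cdot>\<^bsub>C\<^esub> f"
    and "\<And>A B. A \<in> Obj X \<Longrightarrow> B \<in> Obj X \<Longrightarrow> hom X A B = hom C A B"
  using assms by (auto simp: full_subcategory_def subcategory_def)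

context category
begin

lemma hom_Obj:
  assumes "f \<in> hom C A B"
  shows "A \<in> Obj C" "B \<in> Obj C"
  using assms Dom_Obj Cod_Obj by (auto simp: hom_def)

lemma isoI:
  assumes "f \<in> hom C A B" "g \<in> hom C B A" "g \<cdot> f = Id C A" "f \<cdot> g = Id C B"
  shows "iso C f"
  using assms by (auto simp: iso_def dest: homD)

lemma iso_inverse:
  assumes "iso C f" "f \<in> hom C A B"
  obtains g where "g \<in> hom C B A" "g \<cdot> f = Id C A" "f \<cdot> g = Id C B" "iso C g"
proof -
  obtain g where "g \<in> hom C B A" "g \<cdot> f = Id C A" "f \<cdot> g = Id C B"
    using assms by (auto simp: iso_def dest: homD)
  then show ?thesis using that isoI assms(2) by blast
qed

lemma iso_Id: "A \<in> Obj C \<Longrightarrow> iso C (Id C A)"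
  using isoI Id_hom Id_left by blast

lemma universal_arrow_unique:
  assumes "universal_arrow C X A B e" "Y \<in> Obj X" "g \<in> hom C B Y" "h \<in> hom C B Y"
    and "g \<cdot> e = h \<cdot> e"
  shows "g = h"
  using assms Comp_hom[OF universal_arrowD(2)[OF assms(1)] assms(4)]
  by (auto simp: universal_arrow_def)

text \<open>Both \<open>e \<cdot> d\<close> and the identity of \<open>B\<close> extend
  \<open>e\<close> along itself, so they agree and \<open>d\<close> is an isomorphism. Its domain
  \<open>B\<close> lies in \<open>X\<close>, so repleteness is applied to \<open>d\<close> rather
  than to \<open>e\<close>.\<close>

lemma universal_arrow_retract:
  assumes e: "universal_arrow C X A B e" and d: "d \<in> hom C B A" "d \<cdot> e = Id C A"
    and X: "replete X C"
  shows "A \<in> Obj X"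
proof -
  note eh = universal_arrowD[OF e]
  have "(e \<cdot> d) \<cdot> e = Id C B \<cdot> e"
    using Comp_assoc[OF eh(2) d(1) eh(2)] d(2) Id_right[OF eh(2)] Id_left[OF eh(2)] by simp
  then have "e \<cdot> d = Id C B"
    using universal_arrow_unique[OF e eh(1)] Comp_hom[OF d(1) eh(2)] Id_hom hom_Obj(2)[OF eh(2)]
    by blast
  then have "iso C d" using isoI[OF d(1) eh(2)] d(2) by blast
  then show ?thesis using X eh(1) homD[OF d(1)] by (auto simp: replete_def)
qed

end

section \<open>Reflections as families of universal arrows\<close>

lemma reflection_unit_universal:
  assumes "full_subcategory X C" "is_reflection X C R \<eta>" "A \<in> Obj C"
  shows "universal_arrow C X A (OMap R A) (\<eta> A)"
proof -
  have adj: "is_functor C X R" "nat_trans C C identity_maps (functor_comp identity_maps R) \<eta>"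
    "\<And>Y. Y \<in> Obj X \<Longrightarrow> bij_betw (\<lambda>g. g \<cdot>\<^bsub>C\<^esub> \<eta> A) (hom X (OMap R A) Y) (hom C A Y)"
    using assms(2,3) by (auto simp: is_reflection_def adjunction_def identity_maps_def)
  have RA: "OMap R A \<in> Obj X" using adj(1) assms(3) by (auto simp: is_functor_def)
  have \<eta>: "\<eta> A \<in> hom C A (OMap R A)"
    using adj(2) assms(3) by (auto simp: nat_trans_def identity_maps_def functor_comp_def)
  have "\<exists>!g. g \<in> hom C (OMap R A) Y \<and> g \<cdot>\<^bsub>C\<^esub> \<eta> A = f" if "Y \<in> Obj X" "f \<in> hom C A Y" for Y f
  proof -
    let ?H = "hom C (OMap R A) Y"
    have "bij_betw (\<lambda>g. g \<cdot>\<^bsub>C\<^esub> \<eta> A) ?H (hom C A Y)"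
      using adj(3)[OF that(1)] full_subcategoryD(10)[OF assms(1) RA that(1)] by simp
    \<comment> \<open>Injectivity of precomposition with the unit is the uniqueness of extensions,
      surjectivity their existence. Fullness has replaced the morphisms of \<open>X\<close> by those
      of \<open>C\<close>.\<close>
    then have "inj_on (\<lambda>g. g \<cdot>\<^bsub>C\<^esub> \<eta> A) ?H" "f \<in> (\<lambda>g. g \<cdot>\<^bsub>C\<^esub> \<eta> A) ` ?H"
      using that(2) by (simp_all add: bij_betw_def)
    then show ?thesis by (auto simp: inj_on_def)
  qed
  then show ?thesis using RA \<eta> by (auto simp: universal_arrow_def)
qed

text \<open>Uniqueness of extensions makes an object-wise choice functorial. The given
  \<open>\<eta>\<close> itself becomes the unit, so membership of its components in \<open>E\<close>
  is preserved.\<close>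

lemma universal_arrows_reflection:
  fixes C :: "('o, 'a) cat" (structure)
  assumes full: "full_subcategory X C"
    and univ: "\<And>A. A \<in> Obj C \<Longrightarrow> universal_arrow C X A (B A) (\<eta> A)"
  shows "\<exists>R. is_reflection X C R \<eta>"
proof -
  note sub = full_subcategoryD[OF full]
  interpret category C by (rule sub(3))
  note B = universal_arrowD(1)[OF univ] and \<eta> = universal_arrowD(2)[OF univ]
  \<comment> \<open>The condition on \<open>g\<close> is the naturality square of
    \<open>\<eta>\<close> at \<open>f\<close>, so naturality holds by construction.\<close>
  define r where "r f = (THE g. g \<in> hom C (B (Dom C f)) (B (Cod C f)) \<and>
    g \<cdot> \<eta> (Dom C f) = \<eta> (Cod C f) \<cdot> f)" for f
  have r: "r f \<in> hom C (B A) (B A') \<and> r f \<cdot> \<eta> A = \<eta> A' \<cdot> f" if f: "f \<in> hom C A A'" for f A A'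
  proof -
    have "\<exists>!g. g \<in> hom C (B A) (B A') \<and> g \<cdot> \<eta> A = \<eta> A' \<cdot> f"
      using univ[OF hom_Obj(1)[OF f]] B[OF hom_Obj(2)[OF f]]
        Comp_hom[OF f \<eta>[OF hom_Obj(2)[OF f]]]
      by (auto simp: universal_arrow_def)
    from theI'[OF this] show ?thesis using homD[OF f] by (simp add: r_def)
  qed
  \<comment> \<open>Uniqueness as a rewriting principle: each functor law follows by checking that
    its right-hand side fills the same naturality square.\<close>
  have r_eq: "r f = g" if f: "f \<in> hom C A A'" and g: "g \<in> hom C (B A) (B A')"
    "g \<cdot> \<eta> A = \<eta> A' \<cdot> f" for f g A A'
    using universal_arrow_unique[OF univ B] hom_Obj[OF f] r[OF f] g by simp
  have r_Id: "r (Id C A) = Id C (B A)" if "A \<in> Obj C" for A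
    using r_eq[OF Id_hom] that Id_left[OF \<eta>] Id_right[OF \<eta>] Id_hom hom_Obj(2)[OF \<eta>] by simp
  have r_Comp: "r (g \<cdot> f) = r g \<cdot> r f" if f: "f \<in> hom C A A'" and g: "g \<in> hom C A' A''"
    for f g A A' A''
  proof (rule r_eq[OF Comp_hom[OF f g]])
    note rf = r[OF f] and rg = r[OF g] and o = hom_Obj[OF f] hom_Obj[OF g]
    show "r g \<cdot> r f \<in> hom C (B A) (B A'')" using rf rg Comp_hom by blast
    have "(r g \<cdot> r f) \<cdot> \<eta> A = r g \<cdot> (\<eta> A' \<cdot> f)"
      using Comp_assoc[OF \<eta>[OF o(1)]] rf rg by metis
    also have "\<dots> = (\<eta> A'' \<cdot> g) \<cdot> f" using Comp_assoc[OF f \<eta>[OF o(2)]] rg by metis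
    also have "\<dots> = \<eta> A'' \<cdot> (g \<cdot> f)" using Comp_assoc[OF f g \<eta>[OF o(4)]] .
    finally show "(r g \<cdot> r f) \<cdot> \<eta> A = \<eta> A'' \<cdot> (g \<cdot> f)" .
  qed
  define R where "R = \<lparr>OMap = B, AMap = r\<rparr>"
  have fold_hom: "f \<in> hom C (Dom C f) (Cod C f)" if "f \<in> Arr C" for f
    using that by (simp add: hom_def)
  have rX: "r f \<in> hom X (B (Dom C f)) (B (Cod C f))" if "f \<in> Arr C" for f
    using r[OF fold_hom[OF that]] sub(10) B Dom_Obj Cod_Obj that by simp
  have R: "is_functor C X R"
    unfolding is_functor_def R_def
  proof (intro conjI ballI impI sub(2,3), simp_all add: B rX r_Id sub(8))
    fix f g assume fg: "f \<in> Arr C" "g \<in> Arr C" "Cod C f = Dom C g"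
    then have "r (g \<cdot> f) = r g \<cdot> r f" using r_Comp fold_hom by metis
    also have "\<dots> = r g \<cdot>\<^bsub>X\<^esub> r f"
      using sub(9)[of "r f" "r g"] rX[OF fg(1)] rX[OF fg(2)] fg(3) homD[OF rX[OF fg(1)]]
        homD[OF rX[OF fg(2)]] by simp
    finally show "r (g \<cdot> f) = r g \<cdot>\<^bsub>X\<^esub> r f" .
  qed
  have I: "is_functor X C identity_maps"
    unfolding is_functor_def identity_maps_def
    using sub(2-9) by (auto simp: hom_def)
  have N: "nat_trans C C identity_maps (functor_comp identity_maps R) \<eta>"
    unfolding nat_trans_def is_functor_def identity_maps_def functor_comp_def R_def
    using sub(3,4) B \<eta> r_Id r[OF fold_hom] r_Comp fold_hom
    by (auto dest: homD) (metis fold_hom)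
  have "bij_betw (\<lambda>g. g \<cdot> \<eta> A) (hom X (B A) Y) (hom C A Y)"
    if A: "A \<in> Obj C" and Y: "Y \<in> Obj X" for A Y
    unfolding sub(10)[OF B[OF A] Y] bij_betw_def inj_on_def
  proof (intro conjI ballI impI)
    show "g = h" if "g \<in> hom C (B A) Y" "h \<in> hom C (B A) Y" "g \<cdot> \<eta> A = h \<cdot> \<eta> A" for g h
      using universal_arrow_unique[OF univ[OF A] Y] that by blast
    show "(\<lambda>g. g \<cdot> \<eta> A) ` hom C (B A) Y = hom C A Y"
      using Comp_hom[OF \<eta>[OF A]] universal_arrow_ex[OF univ[OF A] Y] by (auto simp: image_iff) metis
  qed
  then have "is_reflection X C R \<eta>"
    using sub(1) R I N by (auto simp: is_reflection_def adjunction_def R_def identity_maps_def)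
  then show ?thesis ..
qed

lemma complete_cat_product:
  fixes C :: "('o, 'a) cat" (structure)
  assumes C: "complete_cat TYPE('u) C" and I: "small TYPE('u) (I :: 'u set)"
    and F: "\<And>i. i \<in> I \<Longrightarrow> F i \<in> Obj C"
  obtains P p where "is_product C I F P p"
proof -
  interpret category C using C by (simp add: complete_cat_def)
  \<comment> \<open>The discrete category on \<open>I\<close>: every index is its own identity
    arrow. Composable arrows coincide, so returning either argument gives the composite.\<close>
  define J :: "('u, 'u) cat" where
    "J = \<lparr>Obj = I, Arr = I, Dom = id, Cod = id, Id = id, Comp = (\<lambda>g f. f)\<rparr>"
  define T where "T = \<lparr>OMap = F, AMap = (\<lambda>i. Id C (F i))\<rparr>"
  have "category J" by unfold_locales (auto simp: J_def hom_def)
  then have "is_functor J C T"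
    using F Id_hom Id_left[OF Id_hom] category_axioms by (auto simp: is_functor_def J_def T_def)
  moreover have "small TYPE('u) (Obj J)" "small TYPE('u) (Arr J)" using I by (simp_all add: J_def)
  ultimately obtain P p where lim: "is_limit J C T P p"
    using C unfolding complete_cat_def by blast
  \<comment> \<open>All arrows of \<open>J\<close> are sent to identities, so cone compatibility is
    automatic and limits of \<open>T\<close> are exactly products of \<open>F\<close>.\<close>
  have cone: "is_cone J C T D q \<longleftrightarrow> D \<in> Obj C \<and> (\<forall>i \<in> I. q i \<in> hom C D (F i))" for D q
    using Id_left by (auto simp: is_cone_def J_def T_def)
  have "is_product C I F P p"
    using lim F unfolding is_limit_def cone is_product_def by (simp add: J_def)
  then show ?thesis by (rule that)
qed

section \<open>Factorization systems whose left class consists of epimorphisms\<close>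

locale epi_factorization = category C for C :: "('o, 'a) cat" (structure) +
  fixes X :: "('o, 'a) cat" and E M :: "'a set"
  assumes fact: "factorization_system C E M"
    and epis: "e \<in> E \<Longrightarrow> epi C e"
    and full: "full_subcategory X C"
    and repl: "replete X C"
begin

lemmas sub = full_subcategoryD[OF full]

lemma iso_in_E: "iso C f \<Longrightarrow> f \<in> E"
  using fact by (simp add: factorization_system_def)

lemma E_Comp: "f \<in> hom C A B \<Longrightarrow> g \<in> hom C B D \<Longrightarrow> f \<in> E \<Longrightarrow> g \<in> E \<Longrightarrow> g \<cdot> f \<in> E"
  using fact by (simp add: factorization_system_def hom_def)

lemma factorize:
  assumes "f \<in> hom C A D"
  obtains e m B where "e \<in> E" "m \<in> M" "e \<in> hom C A B" "m \<in> hom C B D" "f = m \<cdot> e"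
proof -
  obtain e m where em: "e \<in> E" "m \<in> M" "Cod C e = Dom C m" "f = m \<cdot> e"
    using fact homD(1)[OF assms] unfolding factorization_system_def by metis
  have e: "e \<in> hom C (Dom C e) (Dom C m)" and m: "m \<in> hom C (Dom C m) (Cod C m)"
    using em fact by (auto simp: hom_def factorization_system_def)
  have "Dom C e = A" "Cod C m = D"
    using homD[OF Comp_hom[OF e m]] homD[OF assms] em(4) by simp_all
  with that em e m show ?thesis by metis
qed

lemma diagonal:
  assumes "e \<in> E" "m \<in> M" "e \<in> hom C A B" "m \<in> hom C D F" "u \<in> hom C A D" "v \<in> hom C B F"
    and "m \<cdot> u = v \<cdot> e"
  obtains d where "d \<in> hom C B D" "d \<cdot> e = u" "m \<cdot> d = v"
proof -
  have "\<forall>u \<in> hom C (Dom C e) (Dom C m). \<forall>v \<in> hom C (Cod C e) (Cod C m). m \<cdot> u = v \<cdot> e \<longrightarrow>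
      (\<exists>d. d \<in> hom C (Cod C e) (Dom C m) \<and> d \<cdot> e = u \<and> m \<cdot> d = v)"
    using assms(1,2) fact unfolding factorization_system_def by blast
  then show ?thesis using that assms(5-7) homD[OF assms(3)] homD[OF assms(4)] by auto
qed

lemma subobject_in_subcategory:
  "closed_under_subobjects X C M \<Longrightarrow> m \<in> M \<Longrightarrow> m \<in> hom C A B \<Longrightarrow> B \<in> Obj X \<Longrightarrow> A \<in> Obj X"
  by (auto simp: closed_under_subobjects_def dest: homD)

section \<open>Closure properties of reflective subcategories\<close>

lemma closed_under_products_if_reflection:
  assumes "is_reflection X C R \<eta>"
  shows "closed_under_products TYPE('u) X C"
  unfolding closed_under_products_def
proof (intro allI impI, elim conjE)
  fix I :: "'u set" and F P p
  assume F: "\<forall>i\<in>I. F i \<in> Obj X" and "is_product C I F P p"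
  then have P: "P \<in> Obj C" and p: "\<And>i. i \<in> I \<Longrightarrow> p i \<in> hom C P (F i)"
    and ump: "\<And>B q. B \<in> Obj C \<Longrightarrow> (\<And>i. i \<in> I \<Longrightarrow> q i \<in> hom C B (F i)) \<Longrightarrow>
      \<exists>!h. h \<in> hom C B P \<and> (\<forall>i \<in> I. p i \<cdot> h = q i)"
    by (auto simp: is_product_def)
  note \<eta> = reflection_unit_universal[OF full assms P]
  note \<eta>h = universal_arrowD(2)[OF \<eta>]
  have "\<forall>i\<in>I. \<exists>g. g \<in> hom C (OMap R P) (F i) \<and> g \<cdot> \<eta> P = p i"
    using \<eta> F p universal_arrow_ex by metis
  then obtain q where q: "\<And>i. i \<in> I \<Longrightarrow> q i \<in> hom C (OMap R P) (F i)"
    "\<And>i. i \<in> I \<Longrightarrow> q i \<cdot> \<eta> P = p i"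
    by metis
  \<comment> \<open>The projections extend along the unit to the \<open>q i\<close>, because their
    targets lie in \<open>X\<close>; \<open>h\<close> is the induced map into the product. Then
    \<open>h \<cdot> \<eta> P\<close> and the identity have the same projections.\<close>
  obtain h where h: "h \<in> hom C (OMap R P) P" "\<And>i. i \<in> I \<Longrightarrow> p i \<cdot> h = q i"
    using ump[OF hom_Obj(2)[OF \<eta>h] q(1)] by blast
  have "p i \<cdot> (h \<cdot> \<eta> P) = p i" if "i \<in> I" for i
    using Comp_assoc[OF \<eta>h h(1) p[OF that]] h(2) q(2) that by simp
  then have "h \<cdot> \<eta> P = Id C P"
    using ump[OF P p] Comp_hom[OF \<eta>h h(1)] Id_hom[OF P] Id_right[OF p] by blast
  then show "P \<in> Obj X" using universal_arrow_retract[OF \<eta> h(1)] repl by blast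
qed

lemma closed_under_subobjects_if_reflection:
  assumes refl: "is_reflection X C R \<eta>" and E: "\<forall>A\<in>Obj C. \<eta> A \<in> E"
  shows "closed_under_subobjects X C M"
  unfolding closed_under_subobjects_def
proof (intro ballI impI)
  fix m assume m: "m \<in> M" "Cod C m \<in> Obj X"
  have mh: "m \<in> hom C (Dom C m) (Cod C m)"
    using m(1) fact by (auto simp: factorization_system_def hom_def)
  note A = hom_Obj(1)[OF mh]
  note \<eta> = reflection_unit_universal[OF full refl A]
  obtain v where v: "v \<in> hom C (OMap R (Dom C m)) (Cod C m)" "v \<cdot> \<eta> (Dom C m) = m"
    using universal_arrow_ex[OF \<eta> m(2) mh] .
  \<comment> \<open>The square has the unit on the left, \<open>m\<close> on the right, the identity
    on top and \<open>v\<close> at the bottom. The upper triangle of its filler says that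
    \<open>d\<close> is a left inverse of the unit.\<close>
  obtain d where "d \<in> hom C (OMap R (Dom C m)) (Dom C m)" "d \<cdot> \<eta> (Dom C m) = Id C (Dom C m)"
    using diagonal[OF _ m(1) universal_arrowD(2)[OF \<eta>] mh Id_hom[OF A] v(1)] E A v(2) Id_right[OF mh]
    by auto
  then show "Dom C m \<in> Obj X" using universal_arrow_retract[OF \<eta>] repl by blast
qed

text \<open>Closure puts the middle object of \<open>u = m \<cdot> e\<close> into \<open>X\<close>,
  so \<open>e\<close> extends along \<open>u\<close> to some \<open>g\<close>. Universality of
  \<open>u\<close> gives \<open>m \<cdot> g = Id C B\<close>, while
  \<open>g \<cdot> m = Id C D\<close> holds because \<open>e\<close> is epi. Thus \<open>m\<close>
  is an isomorphism, and \<open>u\<close> is a composite of members of \<open>E\<close>.\<close>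

lemma universal_arrow_in_E:
  assumes sc: "closed_under_subobjects X C M" and u: "universal_arrow C X A B u"
  shows "u \<in> E"
proof -
  note uh = universal_arrowD[OF u]
  obtain e m D where em: "e \<in> E" "m \<in> M" "e \<in> hom C A D" "m \<in> hom C D B" "u = m \<cdot> e"
    using factorize[OF uh(2)] .
  have D: "D \<in> Obj X" using subobject_in_subcategory[OF sc em(2,4) uh(1)] .
  obtain g where g: "g \<in> hom C B D" "g \<cdot> u = e" using universal_arrow_ex[OF u D em(3)] .
  have "(m \<cdot> g) \<cdot> u = Id C B \<cdot> u"
    using Comp_assoc[OF uh(2) g(1) em(4)] g(2) em(5) Id_left[OF uh(2)] by simp
  then have mg: "m \<cdot> g = Id C B"
    using universal_arrow_unique[OF u uh(1)] Comp_hom[OF g(1) em(4)] Id_hom hom_Obj(2)[OF uh(2)]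
    by blast
  have "(g \<cdot> m) \<cdot> e = Id C D \<cdot> e"
    using Comp_assoc[OF em(3,4) g(1)] g(2) em(5) Id_left[OF em(3)] by simp
  then have gm: "g \<cdot> m = Id C D"
    using epiD[OF epis[OF em(1)] em(3)] Comp_hom[OF em(4) g(1)] Id_hom hom_Obj(2)[OF em(3)]
    by blast
  have "m \<in> E" using iso_in_E isoI[OF em(4) g(1) gm mg] .
  then show ?thesis using E_Comp em by blast
qed

section \<open>Co-well-poweredness and existence of universal arrows\<close>

lemma quotient_equiv_equiv:
  assumes "A \<in> Obj C"
  shows "equiv (morphisms_from C E A) (quotient_equiv C E A)"
proof -
  have hom: "e \<in> hom C A (Cod C e)" if "e \<in> morphisms_from C E A" for e
    using that fact by (auto simp: morphisms_from_def hom_def factorization_system_def)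
  show ?thesis
  proof (rule equivI)
    show "quotient_equiv C E A \<subseteq> morphisms_from C E A \<times> morphisms_from C E A"
      by (auto simp: quotient_equiv_def)
    show "refl_on (morphisms_from C E A) (quotient_equiv C E A)"
      using hom iso_Id Id_hom Id_left hom_Obj(2)
      by (fastforce simp: refl_on_def quotient_equiv_def)
    show "sym (quotient_equiv C E A)"
    proof (rule symI)
      fix e e' assume "(e, e') \<in> quotient_equiv C E A"
      then obtain h where e: "e \<in> morphisms_from C E A" "e' \<in> morphisms_from C E A"
        and h: "h \<in> hom C (Cod C e) (Cod C e')" "iso C h" "e' = h \<cdot> e"
        by (auto simp: quotient_equiv_def)
      obtain g where g: "g \<in> hom C (Cod C e') (Cod C e)" "g \<cdot> h = Id C (Cod C e)" "iso C g"
        using iso_inverse[OF h(2,1)] by blast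
      have "g \<cdot> e' = e"
        using Comp_assoc[OF hom[OF e(1)] h(1) g(1)] Id_left[OF hom[OF e(1)]] g(2) h(3) by simp
      then show "(e', e) \<in> quotient_equiv C E A" using e g by (auto simp: quotient_equiv_def)
    qed
    show "trans (quotient_equiv C E A)"
    proof (rule transI)
      fix e e' e'' assume "(e, e') \<in> quotient_equiv C E A" "(e', e'') \<in> quotient_equiv C E A"
      then obtain h k where e: "e \<in> morphisms_from C E A" "e'' \<in> morphisms_from C E A"
        and h: "h \<in> hom C (Cod C e) (Cod C e')" "iso C h" "e' = h \<cdot> e"
        and k: "k \<in> hom C (Cod C e') (Cod C e'')" "iso C k" "e'' = k \<cdot> e'"
        by (auto simp: quotient_equiv_def)
      obtain h' where h': "h' \<in> hom C (Cod C e') (Cod C e)" "h' \<cdot> h = Id C (Cod C e)"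
        "h \<cdot> h' = Id C (Cod C e')"
        using iso_inverse[OF h(2,1)] by blast
      obtain k' where k': "k' \<in> hom C (Cod C e'') (Cod C e')" "k' \<cdot> k = Id C (Cod C e')"
        "k \<cdot> k' = Id C (Cod C e'')"
        using iso_inverse[OF k(2,1)] by blast
      note kh = Comp_hom[OF h(1) k(1)] and hk = Comp_hom[OF k'(1) h'(1)]
      have "(h' \<cdot> k') \<cdot> (k \<cdot> h) = h' \<cdot> ((k' \<cdot> k) \<cdot> h)"
        using Comp_assoc[OF kh k'(1) h'(1)] Comp_assoc[OF h(1) k(1) k'(1)] by simp
      then have 1: "(h' \<cdot> k') \<cdot> (k \<cdot> h) = Id C (Cod C e)"
        using h' k' Id_left[OF h(1)] by simp
      have "(k \<cdot> h) \<cdot> (h' \<cdot> k') = k \<cdot> ((h \<cdot> h') \<cdot> k')"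
        using Comp_assoc[OF hk h(1) k(1)] Comp_assoc[OF k'(1) h'(1) h(1)] by simp
      then have 2: "(k \<cdot> h) \<cdot> (h' \<cdot> k') = Id C (Cod C e'')"
        using h' k' Id_left[OF k'(1)] by simp
      have "e'' = (k \<cdot> h) \<cdot> e" using Comp_assoc[OF hom[OF e(1)] h(1) k(1)] h(3) k(3) by simp
      then show "(e, e'') \<in> quotient_equiv C E A"
        using e kh isoI[OF kh hk 1 2] by (auto simp: quotient_equiv_def)
    qed
  qed
qed

lemma universal_arrow_exists:
  assumes comp: "complete_cat TYPE('u) C" and cwp: "co_well_powered TYPE('u) C E"
    and pc: "closed_under_products TYPE('u) X C" and sc: "closed_under_subobjects X C M"
    and A: "A \<in> Obj C"
  shows "\<exists>e B. e \<in> E \<and> universal_arrow C X A B e"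
proof -
  let ?r = "quotient_equiv C E A"
  note eqv = quotient_equiv_equiv[OF A]
  define S where "S = {e \<in> morphisms_from C E A. Cod C e \<in> Obj X}"
  define Q where "Q = (\<lambda>e. ?r `` {e}) ` S"
  have "Q \<subseteq> morphisms_from C E A // ?r" by (auto simp: Q_def S_def quotient_def)
  then have sQ: "Q \<prec> (UNIV :: 'u set)"
    using cwp A by (meson co_well_powered_def small_def subset_imp_lepoll lesspoll_trans1)
  \<comment> \<open>Closure under products speaks of index sets inside \<open>'u\<close>, so the
    equivalence classes are encoded there; smallness of \<open>Q\<close> makes an injection
    available.\<close>
  then obtain \<phi> :: "'a set \<Rightarrow> 'u" where \<phi>: "inj_on \<phi> Q" by (auto simp: lesspoll_def lepoll_def)
  define I :: "'u set" where "I = \<phi> ` Q"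
  have I: "small TYPE('u) I"
    unfolding small_def I_def
    using sQ inj_on_image_eqpoll_self[OF \<phi>] eq_lesspoll_trans by blast
  have "\<forall>i\<in>I. \<exists>e\<in>S. i = \<phi> (?r `` {e})" by (auto simp: I_def Q_def)
  \<comment> \<open>\<open>s\<close> selects one representative quotient for each encoded
    class.\<close>
  then obtain s where s: "\<And>i. i \<in> I \<Longrightarrow> s i \<in> S" "\<And>i. i \<in> I \<Longrightarrow> i = \<phi> (?r `` {s i})"
    by metis
  have sh: "s i \<in> hom C A (Cod C (s i))" "Cod C (s i) \<in> Obj X" if "i \<in> I" for i
    using s(1)[OF that] fact by (auto simp: S_def morphisms_from_def hom_def factorization_system_def)
  obtain P p where prod: "is_product C I (\<lambda>i. Cod C (s i)) P p"
    using complete_cat_product[OF comp I, of "\<lambda>i. Cod C (s i)"] sh(2) sub(4) by blast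
  then have p: "\<And>i. i \<in> I \<Longrightarrow> p i \<in> hom C P (Cod C (s i))" by (auto simp: is_product_def)
  have P: "P \<in> Obj X"
    using pc[unfolded closed_under_products_def, rule_format, of I "\<lambda>i. Cod C (s i)"] I sh(2) prod by simp
  \<comment> \<open>\<open>t\<close> is the tuple of all representatives. It need not lie in
    \<open>E\<close>; its \<open>E\<close>-part \<open>e\<close> is the candidate universal arrow,
    and \<open>B\<close> is in \<open>X\<close> as an \<open>M\<close>-subobject of
    \<open>P\<close>.\<close>
  obtain t where t: "t \<in> hom C A P" "\<And>i. i \<in> I \<Longrightarrow> p i \<cdot> t = s i"
    using prod[unfolded is_product_def] A sh(1) by blast
  obtain e m B where em: "e \<in> E" "m \<in> M" "e \<in> hom C A B" "m \<in> hom C B P" "t = m \<cdot> e"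
    using factorize[OF t(1)] .
  have B: "B \<in> Obj X" using subobject_in_subcategory[OF sc em(2,4) P] .
  have "\<exists>g. g \<in> hom C B Y \<and> g \<cdot> e = f" if Y: "Y \<in> Obj X" and f: "f \<in> hom C A Y" for Y f
  proof -
    obtain e' m' D where em': "e' \<in> E" "m' \<in> M" "e' \<in> hom C A D" "m' \<in> hom C D Y" "f = m' \<cdot> e'"
      using factorize[OF f] .
    have D: "D \<in> Obj X" using subobject_in_subcategory[OF sc em'(2,4) Y] .
    have e'S: "e' \<in> S" using em'(1) homD[OF em'(3)] D by (auto simp: S_def morphisms_from_def)
    \<comment> \<open>The \<open>E\<close>-part of \<open>f\<close> has codomain in
      \<open>X\<close>, so its class occurs among the indices; \<open>s i\<close> is equivalent to
      \<open>e'\<close> but may differ from it.\<close>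
    define i where "i = \<phi> (?r `` {e'})"
    have i: "i \<in> I" using e'S by (auto simp: I_def Q_def i_def)
    have "?r `` {s i} = ?r `` {e'}"
      using inj_onD[OF \<phi>, of "?r `` {s i}" "?r `` {e'}"] s[OF i] e'S
      by (auto simp: Q_def i_def)
    \<comment> \<open>For an equivalence relation, equal classes have related representatives; this
      supplies the comparison \<open>h\<close> from \<open>s i\<close> to \<open>e'\<close>.\<close>
    then have "(s i, e') \<in> ?r"
      using eq_equiv_class[OF _ eqv] e'S by (auto simp: S_def)
    then obtain h where h: "h \<in> hom C (Cod C (s i)) D" "e' = h \<cdot> s i"
      using homD[OF em'(3)] by (auto simp: quotient_equiv_def)
    note pm = Comp_hom[OF em(4) p[OF i]]
    note hpm = Comp_hom[OF pm h(1)]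
    have "(p i \<cdot> m) \<cdot> e = s i" using Comp_assoc[OF em(3,4) p[OF i]] t(2)[OF i] em(5) by simp
    then have "(h \<cdot> (p i \<cdot> m)) \<cdot> e = e'" using Comp_assoc[OF em(3) pm h(1)] h(2) by simp
    \<comment> \<open>The extension of \<open>f\<close> runs from \<open>B\<close> into the product,
      projects to the factor \<open>i\<close>, passes to \<open>D\<close> by \<open>h\<close>, and
      ends with \<open>m'\<close>.\<close>
    then have "(m' \<cdot> (h \<cdot> (p i \<cdot> m))) \<cdot> e = f"
      using Comp_assoc[OF em(3) hpm em'(4)] em'(5) by simp
    then show ?thesis using Comp_hom[OF hpm em'(4)] by blast
  qed
  moreover have "g = h" if "g \<in> hom C B Y" "h \<in> hom C B Y" "g \<cdot> e = h \<cdot> e" for g h Y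
    using epiD[OF epis[OF em(1)] em(3)] that by blast
  ultimately have "universal_arrow C X A B e"
    using B em(3) unfolding universal_arrow_def by metis
  with em(1) show ?thesis by blast
qed

end

section \<open>Equivalence of the three conditions\<close>

theorem theorem2p7:
  fixes C X :: "('o, 'a) cat" and E M :: "'a set"
  assumes "complete_cat TYPE('u) C"
    and "factorization_system C E M"
    and "\<forall>e \<in> E. epi C e"
    and "co_well_powered TYPE('u) C E"
    and "full_subcategory X C"
    and "replete X C"
  shows "((closed_under_products TYPE('u) X C \<and> closed_under_subobjects X C M) \<longleftrightarrow>
          (\<exists>R \<eta>. is_reflection X C R \<eta> \<and> (\<forall>A \<in> Obj C. \<eta> A \<in> E)))
       \<and> ((\<exists>R \<eta>. is_reflection X C R \<eta> \<and> (\<forall>A \<in> Obj C. \<eta> A \<in> E)) \<longleftrightarrow>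
          (reflective X C \<and> closed_under_subobjects X C M))"
proof -
  interpret epi_factorization C X E M
    using assms by (simp add: complete_cat_def epi_factorization_def epi_factorization_axioms_def)
  have "\<exists>R \<eta>. is_reflection X C R \<eta> \<and> (\<forall>A \<in> Obj C. \<eta> A \<in> E)"
    if closed: "closed_under_products TYPE('u) X C" "closed_under_subobjects X C M"
  proof -
    \<comment> \<open>The implication stands inside the existentials, so that choice yields
      functions on the whole type of objects.\<close>
    have "\<forall>A. \<exists>e B. A \<in> Obj C \<longrightarrow> e \<in> E \<and> universal_arrow C X A B e"
      using universal_arrow_exists[OF assms(1,4) closed] by blast
    then obtain \<eta> B where \<eta>: "\<forall>A. A \<in> Obj C \<longrightarrow> \<eta> A \<in> E \<and> universal_arrow C X A (B A) (\<eta> A)"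
      unfolding choice_iff by (elim exE)
    obtain R where "is_reflection X C R \<eta>"
      using universal_arrows_reflection[OF full, of B \<eta>] \<eta> by blast
    then show ?thesis using \<eta> by blast
  qed
  \<comment> \<open>This holds for every reflection, so the \<open>R\<close> and
    \<open>\<eta>\<close> witnessing reflectivity serve unchanged.\<close>
  moreover have "\<forall>A \<in> Obj C. \<eta> A \<in> E"
    if "is_reflection X C R \<eta>" "closed_under_subobjects X C M" for R \<eta>
    using universal_arrow_in_E[OF that(2) reflection_unit_universal[OF full that(1)]] by blast
  moreover have "closed_under_products TYPE('u) X C" if "is_reflection X C R \<eta>" for R \<eta>
    using closed_under_products_if_reflection[OF that] .
  ultimately show ?thesis
    using closed_under_subobjects_if_reflection unfolding reflective_def by (intro conjI iffI) blast+
qed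

end
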